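(* Let $X=X_\Sigma$ be the $n$-dimensional toric variety of a complete fan $\Sigma$ in $\mathbb{R}^n$ with $k$ rays, and let $f=\sum_\ell f_\ell x^\ell$, $g=\sum_\ell g_\ell x^\ell$ in $S=\mathbb{C}[x_1,\dots,x_k]$ be nonzero homogeneous polynomials with positive coefficients and the same degree in $\mathrm{Cl}(X)$, with $\dim\mathcal{N}(g)=n$ and $\mathcal{N}(f)$ contained in the relative interior of $\mathcal{N}(g)$. Let $\mathcal{I}=\int_{X_{>0}}\frac fg\Omega_X$, $\mathcal{I}^{\rm tr}=\int_{X_{>0}}\frac{f^{\rm tr}}{g^{\rm tr}}\Omega_X$, $h=\frac{f\cdot g^{\rm tr}}{g\cdot f^{\rm tr}}$, and $$M_1=\frac{\min_{\ell\in\mathrm{supp}(f)}f_\ell}{\sum_{\ell\in\mathrm{supp}(g)}g_\ell},\qquad M_2=\frac{\sum_{\ell\in\mathrm{supp}(f)}f_\ell}{\min_{\ell\in\mathrm{supp}(g)}g_\ell}.$$ Let $x^{(1)},\dots,x^{(N)}$ be i.i.d. samples from $X_{>0}$ with distribution $\mu^{\rm tr}_{f,g}=\frac{1}{\mathcal{I}^{\rm tr}}\frac{f^{\rm tr}}{g^{\rm tr}}\Omega_X$, and let $\mathcal{I}_N=\frac{\mathcal{I}^{\rm tr}}{N}\sum_{i=1}^N h(x^{(i)})$. Then $$\sqrt{\mathbb{E}\big[(\mathcal{I}-\mathcal{I}_N)^2\big]}\;\le\;\mathcal{I}^{\rm tr}\cdot\sqrt{\frac{M_2^2-M_1^2}{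N}}.$$
   Context: Let $\Sigma$ be a complete rational polyhedral fan in $\mathbb{R}^n$ with primitive ray generators $v_1,\dots,v_k\in\mathbb{Z}^n$, and $V=[v_1\,\cdots\,v_k]\in\mathbb{Z}^{n\times k}$. Let $X=X_\Sigma$ be the associated toric variety with dense torus $T=(\mathbb{C}^* )^n$ (coordinates $t_j$). The Cox ring $S=\mathbb{C}[x_1,\dots,x_k]$ is graded by $\mathrm{Cl}(X)=\mathbb{Z}^k/\mathrm{im}(V^\top)$ with $\deg x_i$ the class of the $i$-th unit vector. The Cox quotient map $\pi$ is given on $(\mathbb{C}^* )^k$ by $x\mapsto(\prod_i x_i^{(v_i)_j})_{j=1,\dots,n}\in T$, and $X_{>0}=\pi(\mathbb{R}^k_{>0})\simeq\mathbb{R}^n_{>0}$. The canonical form is $\Omega_X=\sum_{|I|=n}\det(V_I)\bigwedge_{i\in I}\frac{\mathrm{d}x_i}{x_i}$; it is the pullback under $\pi$ of $\bigwedge_{j=1}^n\mathrm{d}t_j/t_j$, is viewed as a form on $X$, and $X_{>0}$ is oriented so that it is positive. For a polynomial $f$ with positive coefficients, $\mathrm{supp}(f)$ is its set of exponent vectors, $\mathcal{N}(f)\subset\mathbb{R}^k$ its Newton polytope, and $f^{\rm tr}(x)=\max_{\ell\in\mathrm{supp}(f)}x^\ell$ for $x\in\mathbb{R}^k_{>0}$. The functions $f/g$, $f^{\rm tr}/g^{\rm tr}$ and $h$ are constant on the fibres of $\pi:\mathbb{R}^k_{>0}\to X_{>0}$ and are viewed as functions on $X_{>0}$. Under the stated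 hypotheses $\mathcal{I}$ and $\mathcal{I}^{\rm tr}$ are finite and positive, and $\mu^{\rm tr}_{f,g}$ is a probability measure on $X_{>0}$. *)

theory Defs
  imports "HOL-Probability.Probability" "HOL-Library.Poly_Mapping"
begin

section \<open>Complete rational polyhedral fans\<close>

text \<open>
  The ambient lattice is \<^typ>\<open>int^'n\<close> inside \<^typ>\<open>real^'n\<close>; the rays, and hence the
  Cox variables, are indexed by the finite type \<open>'k\<close>.
\<close>

definition real_vec :: "int^'n \<Rightarrow> real^'n" where
  "real_vec v = (\<chi> j. of_int (v $ j))"

definition rational_polyhedral_cone :: "(real^'n) set \<Rightarrow> bool" where
  "rational_polyhedral_cone \<sigma> \<longleftrightarrow>
     (\<exists>W :: (int^'n) set. finite W \<and> \<sigma> = convex_cone hull (real_vec ` W))"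

definition strongly_convex :: "(real^'n) set \<Rightarrow> bool" where
  "strongly_convex \<sigma> \<longleftrightarrow> \<sigma> \<inter> uminus ` \<sigma> = {0}"

text \<open>
  For polyhedral cones the nonempty faces in the sense of \<^const>\<open>face_of\<close> are
  exactly the intersections of the cone with its supporting hyperplanes, and the cone itself.
\<close>

definition rational_fan :: "(real^'n) set set \<Rightarrow> bool" where
  "rational_fan \<Delta> \<longleftrightarrow>
     finite \<Delta> \<and>
     (\<forall>\<sigma>\<in>\<Delta>. rational_polyhedral_cone \<sigma> \<and> strongly_convex \<sigma>) \<and>
     (\<forall>\<sigma>\<in>\<Delta>. \<forall>\<tau>. \<tau> face_of \<sigma> \<and> \<tau> \<noteq> {} \<longrightarrow> \<tau> \<in> \<Delta>) \<and>
     (\<forall>\<sigma>\<in>\<Delta>. \<forall>\<tau>\<in>\<Delta>. (\<sigma> \<inter> \<tau>) face_of \<sigma> \<and> (\<sigma> \<inter> \<tau>) face_of \<tau>)"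

definition complete_rational_fan :: "(real^'n) set set \<Rightarrow> bool" where
  "complete_rational_fan \<Delta> \<longleftrightarrow> rational_fan \<Delta> \<and> \<Union>\<Delta> = UNIV"

definition primitive :: "int^'n \<Rightarrow> bool" where
  "primitive v \<longleftrightarrow> Gcd (range (\<lambda>j. v $ j)) = 1"

text \<open>
  \<open>V\<close> is the matrix whose columns are the primitive ray generators of the fan, each ray
  occurring exactly once; the fan therefore has \<^term>\<open>CARD('k)\<close> rays.
\<close>

definition ray_matrix :: "(real^'n) set set \<Rightarrow> int^'k^'n \<Rightarrow> bool" where
  "ray_matrix \<Delta> V \<longleftrightarrow>
     (\<forall>i. primitive (column i V)) \<and>
     bij_betw (\<lambda>i. convex_cone hull {real_vec (column i V)}) UNIV {\<rho> \<in> \<Delta>. aff_dim \<rho> = 1}"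

section \<open>The Cox ring, graded by the class group\<close>

text \<open>
  \<open>('k \<Rightarrow>\<^sub>0 nat) \<Rightarrow>\<^sub>0 real\<close> is the polynomial ring in the variables \<open>x\<^sub>i\<close>, \<open>i :: 'k\<close>: a
  finitely supported map from exponent vectors to coefficients. Only polynomials with positive
  coefficients are considered, so real coefficients suffice.
\<close>

type_synonym 'k cox_poly = "('k \<Rightarrow>\<^sub>0 nat) \<Rightarrow>\<^sub>0 real"

definition positive_coeffs :: "'k cox_poly \<Rightarrow> bool" where
  "positive_coeffs f \<longleftrightarrow> (\<forall>l\<in>Poly_Mapping.keys f. Poly_Mapping.lookup f l > 0)"

definition class_group :: "int^'k^'n \<Rightarrow> (int^'k) set set" where
  "class_group V = UNIV // {(a, b). b - a \<in> range (\<lambda>m. transpose V *v m)}"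

definition divisor_class :: "int^'k^'n \<Rightarrow> int^'k \<Rightarrow> (int^'k) set" where
  "divisor_class V a = {(a, b). b - a \<in> range (\<lambda>m. transpose V *v m)} `` {a}"

definition exponent_int :: "('k::finite \<Rightarrow>\<^sub>0 nat) \<Rightarrow> int^'k" where
  "exponent_int l = (\<chi> i. int (Poly_Mapping.lookup l i))"

definition homogeneous :: "int^'k^'n \<Rightarrow> (int^'k) set \<Rightarrow> 'k::finite cox_poly \<Rightarrow> bool" where
  "homogeneous V d f \<longleftrightarrow> (\<forall>l\<in>Poly_Mapping.keys f. divisor_class V (exponent_int l) = d)"

definition newton_polytope :: "'k::finite cox_poly \<Rightarrow> (real^'k) set" where
  "newton_polytope f = convex hull ((\<lambda>l. real_vec (exponent_int l)) ` Poly_Mapping.keys f)"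

definition monomial_at :: "('k::finite \<Rightarrow>\<^sub>0 nat) \<Rightarrow> real^'k \<Rightarrow> real" where
  "monomial_at l x = (\<Prod>i\<in>UNIV. x $ i ^ Poly_Mapping.lookup l i)"

definition poly_at :: "'k::finite cox_poly \<Rightarrow> real^'k \<Rightarrow> real" where
  "poly_at f x = (\<Sum>l\<in>Poly_Mapping.keys f. Poly_Mapping.lookup f l * monomial_at l x)"

definition trop_at :: "'k::finite cox_poly \<Rightarrow> real^'k \<Rightarrow> real" where
  "trop_at f x = Max ((\<lambda>l. monomial_at l x) ` Poly_Mapping.keys f)"

section \<open>The positive part and the canonical form\<close>

definition positive_orthant :: "(real^'k) set" where
  "positive_orthant = {x. \<forall>i. x $ i > 0}"

definition cox_map :: "int^'k^'n \<Rightarrow> 'a::field^'k \<Rightarrow> 'a^'n" where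
  "cox_map V x = (\<chi> j. \<Prod>i\<in>UNIV. x $ i powi (V $ j $ i))"

text \<open>
  The positive part lies in the dense torus and consists of real points, so it is a subset
  of \<^typ>\<open>real^'n\<close> in the torus coordinates.
\<close>

definition positive_part :: "int^'k^'n \<Rightarrow> (real^'n) set" where
  "positive_part V = cox_map V ` positive_orthant"

text \<open>
  A function on the positive orthant that is constant on the fibres of the Cox map, viewed as a
  function on the positive part. Only its values on \<^term>\<open>positive_part V\<close> are meaningful.
\<close>

definition descend :: "int^'k^'n \<Rightarrow> (real^'k \<Rightarrow> real) \<Rightarrow> real^'n \<Rightarrow> real" where
  "descend V F = (SOME G. \<forall>x\<in>positive_orthant. G (cox_map V x) = F x)"

text \<open>
  A differential form of degree \<^term>\<open>CARD('n)\<close> is given by its value at a point \<open>x\<close> on a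
  family \<open>u\<close> of tangent vectors indexed by \<open>'n\<close>. For an injective \<open>s :: 'n \<Rightarrow> 'k\<close> the following is
  the wedge product of the forms \<open>dx\<^sub>i / x\<^sub>i\<close> for \<open>i\<close> in the range of \<open>s\<close>, in the order given by \<open>s\<close>.
\<close>

definition wedge_dlog :: "('n \<Rightarrow> 'k) \<Rightarrow> real^'k \<Rightarrow> ('n::finite \<Rightarrow> real^'k) \<Rightarrow> real" where
  "wedge_dlog s x u = det (\<chi> a b. u b $ s a / x $ s a)"

text \<open>
  The minor \<open>V\<^sub>I\<close> and the wedge product over \<open>I\<close> both depend on an enumeration of \<open>I\<close>,
  but their product does not, so any enumeration \<open>s\<close> of \<open>I\<close> may be used.
\<close>

definition cox_canonical_form ::
    "int^'k^'n \<Rightarrow> real^'k \<Rightarrow> ('n::finite \<Rightarrow> real^'k) \<Rightarrow> real" where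
  "cox_canonical_form V x u =
     (\<Sum>I | I \<subseteq> (UNIV :: 'k set) \<and> card I = CARD('n).
        let s = (SOME s :: 'n \<Rightarrow> 'k. bij_betw s UNIV I)
        in of_int (det (\<chi> a b. V $ a $ s b)) * wedge_dlog s x u)"

text \<open>The canonical form viewed as a form on the positive part: the form whose pullback under the
  Cox map is \<^const>\<open>cox_canonical_form\<close>.\<close>

definition canonical_form ::
    "int^'k^'n \<Rightarrow> real^'n \<Rightarrow> ('n::finite \<Rightarrow> real^'n) \<Rightarrow> real" where
  "canonical_form V =
     (SOME \<omega>. \<forall>x\<in>positive_orthant. \<forall>u.
        \<omega> (cox_map V x) (\<lambda>a. frechet_derivative (cox_map V) (at x) (u a)) =
        cox_canonical_form V x u)"

text \<open>
  Integration against the canonical form over the positive part, oriented so that the form is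
  positive, is integration against the absolute value of its coefficient with respect to the
  volume form of \<^typ>\<open>real^'n\<close>.
\<close>

definition canonical_measure :: "int^'k^'n \<Rightarrow> (real^'n::finite) measure" where
  "canonical_measure V =
     density (restrict_space lborel (positive_part V))
       (\<lambda>t. ennreal \<bar>canonical_form V t (\<lambda>a. axis a 1)\<bar>)"

section \<open>The integrals, the tropical density and the estimator\<close>

definition ratio :: "int^'k^'n \<Rightarrow> 'k::finite cox_poly \<Rightarrow> 'k cox_poly \<Rightarrow> real^'n \<Rightarrow> real" where
  "ratio V f g = descend V (\<lambda>x. poly_at f x / poly_at g x)"

definition trop_ratio :: "int^'k^'n \<Rightarrow> 'k::finite cox_poly \<Rightarrow> 'k cox_poly \<Rightarrow> real^'n \<Rightarrow> real" where
  "trop_ratio V f g = descend V (\<lambda>x. trop_at f x / trop_at g x)"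

definition h_fun :: "int^'k^'n \<Rightarrow> 'k::finite cox_poly \<Rightarrow> 'k cox_poly \<Rightarrow> real^'n \<Rightarrow> real" where
  "h_fun V f g = descend V (\<lambda>x. (poly_at f x * trop_at g x) / (poly_at g x * trop_at f x))"

definition canonical_integral ::
    "int^'k^'n::finite \<Rightarrow> 'k::finite cox_poly \<Rightarrow> 'k cox_poly \<Rightarrow> real" where
  "canonical_integral V f g = (\<integral>t. ratio V f g t \<partial>canonical_measure V)"

definition trop_integral ::
    "int^'k^'n::finite \<Rightarrow> 'k::finite cox_poly \<Rightarrow> 'k cox_poly \<Rightarrow> real" where
  "trop_integral V f g = (\<integral>t. trop_ratio V f g t \<partial>canonical_measure V)"

definition trop_measure ::
    "int^'k^'n::finite \<Rightarrow> 'k::finite cox_poly \<Rightarrow> 'k cox_poly \<Rightarrow> (real^'n) measure" where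
  "trop_measure V f g =
     density (canonical_measure V) (\<lambda>t. ennreal (1 / trop_integral V f g * trop_ratio V f g t))"

definition M1 :: "'k cox_poly \<Rightarrow> 'k cox_poly \<Rightarrow> real" where
  "M1 f g = Min (Poly_Mapping.lookup f ` Poly_Mapping.keys f) / (\<Sum>l\<in>Poly_Mapping.keys g. Poly_Mapping.lookup g l)"

definition M2 :: "'k cox_poly \<Rightarrow> 'k cox_poly \<Rightarrow> real" where
  "M2 f g = (\<Sum>l\<in>Poly_Mapping.keys f. Poly_Mapping.lookup f l) / Min (Poly_Mapping.lookup g ` Poly_Mapping.keys g)"

definition estimator ::
    "int^'k^'n::finite \<Rightarrow> 'k::finite cox_poly \<Rightarrow> 'k cox_poly \<Rightarrow> nat \<Rightarrow> (nat \<Rightarrow> real^'n) \<Rightarrow> real" where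
  "estimator V f g N y = trop_integral V f g / real N * (\<Sum>i=1..N. h_fun V f g (y i))"

end

theory Submission
  imports Defs
begin

text \<open>
  The estimator is \<open>\<I>\<^sup>t\<^sup>r\<close> times an empirical mean of \<open>h\<close>, and importance sampling makes it
  unbiased: since \<open>f/g = h \<cdot> f\<^sup>t\<^sup>r/g\<^sup>t\<^sup>r\<close>, the mean of \<open>h\<close> under \<open>\<mu>\<^sup>t\<^sup>r\<close> is \<open>\<I> / \<I>\<^sup>t\<^sup>r\<close>. Independence
  kills the cross terms of the mean square error (lemma \<open>expectation_square_sum_indep\<close>), so
  that error is \<open>(\<I>\<^sup>t\<^sup>r)\<^sup>2 / N\<close> times the variance of \<open>h\<close>. A random variable with values in
  \<open>[a, b]\<close>, \<open>a \<ge> 0\<close>, has second moment at most \<open>b\<^sup>2\<close> and mean at least \<open>a\<close>, hence variance at most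
  \<open>b\<^sup>2 - a\<^sup>2\<close> (lemma \<open>mean_square_error_le\<close>). That \<open>h\<close> takes values in \<open>[M\<^sub>1, M\<^sub>2]\<close> is the
  comparison of a positive polynomial with its largest monomial (lemma
  \<open>poly_at_trop_at_bounds\<close>).

  The geometric input is that the functions involved live on the positive part. Two
  exponents of the same degree differ by \<open>V\<^sup>T m\<close> with \<open>m\<close> integral, so the quotient of the two
  monomials is the pullback of the character \<open>t\<^sup>m\<close> under the Cox map. Dividing \<open>f\<close>, \<open>g\<close>,
  \<open>f\<^sup>t\<^sup>r\<close>, \<open>g\<^sup>t\<^sup>r\<close> by one common monomial therefore turns all of them into Borel functions of the torus
  coordinates, and the quotients of any two of them descend to Borel functions on the
  positive part (lemma \<open>homogeneous_torus_borel\<close>).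

  Integrability of \<open>f\<^sup>t\<^sup>r/g\<^sup>t\<^sup>r\<close> and \<open>\<I>\<^sup>t\<^sup>r > 0\<close> are read off from the existence of a sample: a random
  variable on a probability space has law \<open>\<mu>\<^sup>t\<^sup>r\<close>, so \<open>\<mu>\<^sup>t\<^sup>r\<close> has mass \<open>1\<close>, whereas it would be
  the zero measure if the Bochner integral \<open>\<I>\<^sup>t\<^sup>r\<close> had its default value \<open>0\<close>.
\<close>

section \<open>Mean square error of an empirical mean\<close>

text \<open>Bienayme's identity: the expectation of a product of two independent centred variables is the
  product of their means, so only the diagonal terms of the expanded square survive.\<close>

lemma (in prob_space) expectation_square_sum_indep:
  fixes Z :: "'i \<Rightarrow> 'a \<Rightarrow> real"
  assumes "finite I" and indep: "indep_vars (\<lambda>_. borel) Z I"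
    and int: "\<And>i. i \<in> I \<Longrightarrow> integrable M (Z i)"
    and int2: "\<And>i. i \<in> I \<Longrightarrow> integrable M (\<lambda>w. (Z i w)\<^sup>2)"
    and mean: "\<And>i. i \<in> I \<Longrightarrow> expectation (Z i) = 0"
  shows "expectation (\<lambda>w. (\<Sum>i\<in>I. Z i w)\<^sup>2) = (\<Sum>i\<in>I. expectation (\<lambda>w. (Z i w)\<^sup>2))"
proof -
  have cross: "integrable M (\<lambda>w. Z i w * Z j w) \<and> expectation (\<lambda>w. Z i w * Z j w) = 0"
    if "i \<in> I" "j \<in> I" "i \<noteq> j" for i j
  proof -
    have ind: "indep_vars (\<lambda>_. borel) Z {i, j}"
      using indep_vars_subset[OF indep] that by auto
    have "integrable M (\<lambda>w. \<Prod>l\<in>{i, j}. Z l w)"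
      by (rule indep_vars_integrable) (use ind int that in auto)
    moreover have "expectation (\<lambda>w. \<Prod>l\<in>{i, j}. Z l w) = (\<Prod>l\<in>{i, j}. expectation (Z l))"
      by (rule indep_vars_lebesgue_integral) (use ind int that in auto)
    ultimately show ?thesis
      using that mean by simp
  qed
  have intp: "integrable M (\<lambda>w. Z i w * Z j w)" if "i \<in> I" "j \<in> I" for i j
    using cross[OF that] int2[OF that(1)] by (cases "i = j") (auto simp: power2_eq_square)
  have "expectation (\<lambda>w. (\<Sum>i\<in>I. Z i w)\<^sup>2) = expectation (\<lambda>w. \<Sum>i\<in>I. \<Sum>j\<in>I. Z i w * Z j w)"
    by (simp add: power2_eq_square sum_product)
  also have "\<dots> = (\<Sum>i\<in>I. \<Sum>j\<in>I. expectation (\<lambda>w. Z i w * Z j w))"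
    using intp by (simp add: Bochner_Integration.integral_sum Bochner_Integration.integrable_sum)
  also have "\<dots> = (\<Sum>i\<in>I. \<Sum>j\<in>I. if j = i then expectation (\<lambda>w. (Z i w)\<^sup>2) else 0)"
    by (intro sum.cong refl) (use cross in \<open>auto simp: power2_eq_square\<close>)
  also have "\<dots> = (\<Sum>i\<in>I. expectation (\<lambda>w. (Z i w)\<^sup>2))"
    using \<open>finite I\<close> by simp
  finally show ?thesis .
qed

text \<open>
  The left-hand side is the variance of \<open>h\<close> divided by \<open>N\<close>. The variance is the second moment, at
  most \<open>b\<^sup>2\<close>, minus the square of the mean, at least \<open>a\<^sup>2\<close> because \<open>a \<ge> 0\<close>.
\<close>

lemma (in prob_space) mean_square_error_le:
  fixes h :: "'b \<Rightarrow> real"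
  assumes "N \<ge> 1"
    and indep: "indep_vars (\<lambda>_. Q) X {1..N}"
    and law: "\<And>i. i \<in> {1..N} \<Longrightarrow> distr M Q (X i) = Q"
    and h[measurable]: "h \<in> borel_measurable Q"
    and bounds: "\<And>t. t \<in> space Q \<Longrightarrow> a \<le> h t \<and> h t \<le> b" and "0 \<le> a"
  shows "expectation (\<lambda>w. ((\<integral>t. h t \<partial>Q) - (\<Sum>i=1..N. h (X i w)) / real N)\<^sup>2)
         \<le> (b\<^sup>2 - a\<^sup>2) / real N"
proof -
  define m where "m = (\<integral>t. h t \<partial>Q)"
  have X[measurable]: "random_variable Q (X i)" if "i \<in> {1..N}" for i
    using indep that by (auto simp: indep_vars_def)
  interpret Q: prob_space Q
    using prob_space_distr[OF X, of 1] law[of 1] \<open>N \<ge> 1\<close> by simp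
  have ae: "AE t in Q. a \<le> h t \<and> h t \<le> b"
    using bounds by auto
  have inth: "integrable Q h"
    by (rule Q.integrable_const_bound[where B = b]) (use bounds \<open>0 \<le> a\<close> in force)+
  have h2: "(h t)\<^sup>2 \<le> b\<^sup>2" if "t \<in> space Q" for t
    using bounds[OF that] \<open>0 \<le> a\<close> by (intro power_mono) auto
  have inth2: "integrable Q (\<lambda>t. (h t)\<^sup>2)"
    by (rule Q.integrable_const_bound[where B = "b\<^sup>2"]) (use h2 in auto)
  have "a \<le> m"
    unfolding m_def using Q.integral_ge_const[OF inth] ae by auto
  then have "a\<^sup>2 \<le> m\<^sup>2"
    using \<open>0 \<le> a\<close> by (intro power_mono) auto
  moreover have "(\<integral>t. (h t)\<^sup>2 \<partial>Q) \<le> b\<^sup>2"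
    using Q.integral_le_const[OF inth2] h2 by auto
  ultimately have var: "(\<integral>t. (h t - m)\<^sup>2 \<partial>Q) \<le> b\<^sup>2 - a\<^sup>2"
    using Q.variance_eq[OF inth inth2] by (simp add: m_def)
  \<comment> \<open>The error of the empirical mean is \<open>- (\<Sum>i. Z i) / N\<close> for the centred samples \<open>Z i\<close>.\<close>
  define Z where "Z i w = h (X i w) - m" for i w
  have indepZ: "indep_vars (\<lambda>_. borel) Z {1..N}"
    unfolding Z_def by (rule indep_vars_compose2[OF indep]) auto
  have transfer: "expectation (\<lambda>w. \<phi> (X i w)) = (\<integral>t. \<phi> t \<partial>Q)"
    "integrable M (\<lambda>w. \<phi> (X i w)) \<longleftrightarrow> integrable Q \<phi>"
    if "i \<in> {1..N}" and [measurable]: "\<phi> \<in> borel_measurable Q" for \<phi> :: "'b \<Rightarrow> real" and i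
    using integral_distr[OF X[OF that(1)], of \<phi>] integrable_distr_eq[OF X[OF that(1)], of \<phi>]
      law[OF that(1)] by simp_all
  have intm2: "integrable Q (\<lambda>t. (h t - m)\<^sup>2)"
    using inth inth2 by (simp add: power2_diff)
  have "expectation (\<lambda>w. (\<Sum>i=1..N. Z i w)\<^sup>2) = (\<Sum>i=1..N. expectation (\<lambda>w. (Z i w)\<^sup>2))"
  proof (rule expectation_square_sum_indep[OF _ indepZ])
    show "integrable M (Z i)" if "i \<in> {1..N}" for i
      unfolding Z_def using transfer(2)[OF that, of "\<lambda>t. h t - m"] inth by simp
    show "integrable M (\<lambda>w. (Z i w)\<^sup>2)" if "i \<in> {1..N}" for i
      unfolding Z_def using transfer(2)[OF that, of "\<lambda>t. (h t - m)\<^sup>2"] intm2 by simp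
    show "expectation (Z i) = 0" if "i \<in> {1..N}" for i
      unfolding Z_def using transfer(1)[OF that, of "\<lambda>t. h t - m"] inth
      by (simp add: m_def Q.prob_space)
  qed simp
  also have "\<dots> = (\<Sum>i=1..N. (\<integral>t. (h t - m)\<^sup>2 \<partial>Q))"
    unfolding Z_def
    by (intro sum.cong refl) (use transfer(1)[of _ "\<lambda>t. (h t - m)\<^sup>2"] in simp)
  also have "\<dots> \<le> real N * (b\<^sup>2 - a\<^sup>2)"
    using var by (simp add: mult_left_mono)
  finally have sum_le: "expectation (\<lambda>w. (\<Sum>i=1..N. Z i w)\<^sup>2) \<le> real N * (b\<^sup>2 - a\<^sup>2)" .
  have "(m - (\<Sum>i=1..N. h (X i w)) / real N)\<^sup>2 = (\<Sum>i=1..N. Z i w)\<^sup>2 / (real N)\<^sup>2" for w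
  proof -
    have "m - (\<Sum>i=1..N. h (X i w)) / real N = - (\<Sum>i=1..N. Z i w) / real N"
      using \<open>N \<ge> 1\<close> by (simp add: Z_def sum_subtractf field_simps)
    then show ?thesis
      by (simp add: power_divide)
  qed
  then have "expectation (\<lambda>w. (m - (\<Sum>i=1..N. h (X i w)) / real N)\<^sup>2)
      = expectation (\<lambda>w. (\<Sum>i=1..N. Z i w)\<^sup>2) / (real N)\<^sup>2"
    by simp
  also have "\<dots> \<le> real N * (b\<^sup>2 - a\<^sup>2) / (real N)\<^sup>2"
    using sum_le by (intro divide_right_mono) auto
  also have "\<dots> = (b\<^sup>2 - a\<^sup>2) / real N"
    using \<open>N \<ge> 1\<close> by (simp add: power2_eq_square)
  finally show ?thesis
    by (simp add: m_def)
qed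

section \<open>A positive polynomial and its tropicalization\<close>

lemma monomial_at_pos:
  assumes "x \<in> positive_orthant"
  shows "monomial_at l x > 0"
  using assms by (auto simp: monomial_at_def positive_orthant_def intro!: prod_pos)

lemma trop_at_pos:
  assumes "f \<noteq> 0" and "x \<in> positive_orthant"
  shows "trop_at f x > 0"
  unfolding trop_at_def using assms(1) monomial_at_pos[OF assms(2)]
  by (subst Max_gr_iff) (auto simp: ex_in_conv)

lemma coeff_sum_pos:
  assumes "f \<noteq> 0" and "positive_coeffs f"
  shows "(\<Sum>l\<in>Poly_Mapping.keys f. Poly_Mapping.lookup f l) > 0"
  using assms by (intro sum_pos) (auto simp: positive_coeffs_def)

lemma Min_coeff_pos:
  assumes "f \<noteq> 0" and "positive_coeffs f"
  shows "Min (Poly_Mapping.lookup f ` Poly_Mapping.keys f) > 0"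
  using assms by (subst Min_gr_iff) (auto simp: positive_coeffs_def)

text \<open>
  Every monomial is at most the largest one, which gives the upper bound; the largest one
  occurs in \<open>f\<close> and the other terms are nonnegative, which gives the lower bound.
\<close>

lemma poly_at_trop_at_bounds:
  assumes "f \<noteq> 0" and pos: "positive_coeffs f" and x: "x \<in> positive_orthant"
  shows "Min (Poly_Mapping.lookup f ` Poly_Mapping.keys f) * trop_at f x \<le> poly_at f x"
    and "poly_at f x \<le> (\<Sum>l\<in>Poly_Mapping.keys f. Poly_Mapping.lookup f l) * trop_at f x"
proof -
  let ?K = "Poly_Mapping.keys f" and ?c = "Poly_Mapping.lookup f"
  have c: "?c l > 0" if "l \<in> ?K" for l
    using pos that by (simp add: positive_coeffs_def)
  have "trop_at f x \<in> (\<lambda>l. monomial_at l x) ` ?K"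
    unfolding trop_at_def using assms(1) by (intro Max_in) auto
  then obtain k where k: "k \<in> ?K" "trop_at f x = monomial_at k x"
    by auto
  have "Min (?c ` ?K) * trop_at f x \<le> ?c k * monomial_at k x"
    using k monomial_at_pos[OF x, of k] by (auto intro!: mult_right_mono Min_le)
  also have "\<dots> \<le> poly_at f x"
    unfolding poly_at_def
    by (rule member_le_sum) (use k c monomial_at_pos[OF x] in \<open>auto intro!: mult_nonneg_nonneg less_imp_le\<close>)
  finally show "Min (?c ` ?K) * trop_at f x \<le> poly_at f x" .
  show "poly_at f x \<le> sum ?c ?K * trop_at f x"
    unfolding poly_at_def sum_distrib_right
    by (intro sum_mono mult_left_mono) (auto simp: trop_at_def less_imp_le c)
qed

lemma poly_at_pos:
  assumes "f \<noteq> 0" and "positive_coeffs f" and "x \<in> positive_orthant"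
  shows "poly_at f x > 0"
  using poly_at_trop_at_bounds(1)[OF assms] Min_coeff_pos[OF assms(1,2)] trop_at_pos[OF assms(1,3)]
  by (meson less_le_trans mult_pos_pos)

lemma M1_nonneg:
  assumes "f \<noteq> 0" "positive_coeffs f" "g \<noteq> 0" "positive_coeffs g"
  shows "0 \<le> M1 f g"
  using Min_coeff_pos[OF assms(1,2)] coeff_sum_pos[OF assms(3,4)] by (simp add: M1_def)

lemma poly_trop_quotient_bounds:
  assumes "f \<noteq> 0" "positive_coeffs f" "g \<noteq> 0" "positive_coeffs g" and x: "x \<in> positive_orthant"
  shows "M1 f g \<le> (poly_at f x * trop_at g x) / (poly_at g x * trop_at f x)"
    and "(poly_at f x * trop_at g x) / (poly_at g x * trop_at f x) \<le> M2 f g"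
proof -
  note bf = poly_at_trop_at_bounds[OF assms(1,2) x] and bg = poly_at_trop_at_bounds[OF assms(3,4) x]
  note pos = trop_at_pos[OF assms(1) x] trop_at_pos[OF assms(3) x]
    poly_at_pos[OF assms(1,2) x] poly_at_pos[OF assms(3,4) x]
    Min_coeff_pos[OF assms(3,4)] coeff_sum_pos[OF assms(3,4)]
    Min_coeff_pos[OF assms(1,2)] coeff_sum_pos[OF assms(1,2)]
  have eq: "(poly_at f x * trop_at g x) / (poly_at g x * trop_at f x)
      = (poly_at f x / trop_at f x) / (poly_at g x / trop_at g x)"
    by simp
  have f: "Min (Poly_Mapping.lookup f ` Poly_Mapping.keys f) \<le> poly_at f x / trop_at f x"
    "poly_at f x / trop_at f x \<le> (\<Sum>l\<in>Poly_Mapping.keys f. Poly_Mapping.lookup f l)"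
    using bf pos by (simp_all add: pos_le_divide_eq pos_divide_le_eq)
  have g: "Min (Poly_Mapping.lookup g ` Poly_Mapping.keys g) \<le> poly_at g x / trop_at g x"
    "poly_at g x / trop_at g x \<le> (\<Sum>l\<in>Poly_Mapping.keys g. Poly_Mapping.lookup g l)"
    using bg pos by (simp_all add: pos_le_divide_eq pos_divide_le_eq)
  show "M1 f g \<le> (poly_at f x * trop_at g x) / (poly_at g x * trop_at f x)"
    unfolding eq M1_def by (rule frac_le) (use f g pos in auto)
  show "(poly_at f x * trop_at g x) / (poly_at g x * trop_at f x) \<le> M2 f g"
    unfolding eq M2_def by (rule frac_le) (use f g pos in auto)
qed

section \<open>Descent to the positive part\<close>

definition torus_character :: "int^'n \<Rightarrow> real^'n::finite \<Rightarrow> real" where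
  "torus_character m t = (\<Prod>j\<in>UNIV. t $ j powi (m $ j))"

lemma torus_character_measurable [measurable]:
  "torus_character m \<in> borel_measurable borel"
  unfolding torus_character_def power_int_def by measurable

lemma power_int_sum:
  fixes a :: "'a::field"
  assumes "a \<noteq> 0"
  shows "a powi (\<Sum>j\<in>J. e j) = (\<Prod>j\<in>J. a powi (e j))"
  using assms by (induction J rule: infinite_finite_induct) (auto simp: power_int_add)

lemma prod_power_int:
  fixes a :: "'i \<Rightarrow> 'a::field"
  shows "(\<Prod>i\<in>I. a i) powi e = (\<Prod>i\<in>I. a i powi e)"
  by (induction I rule: infinite_finite_induct) (auto simp: power_int_mult_distrib)

text \<open>Pulling the character \<open>t\<^sup>m\<close> back along the Cox map gives the Laurent monomial with exponent
  \<open>V\<^sup>T m\<close>.\<close>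

lemma monomial_at_cox_map:
  fixes V :: "int^'k^'n::finite" and l k :: "'k::finite \<Rightarrow>\<^sub>0 nat"
  assumes "exponent_int l - exponent_int k = transpose V *v m" and x: "x \<in> positive_orthant"
  shows "monomial_at l x = monomial_at k x * torus_character m (cox_map V x)"
proof -
  have x0: "x $ i \<noteq> 0" for i
    using x by (auto simp: positive_orthant_def less_le)
  have e: "int (Poly_Mapping.lookup l i) = int (Poly_Mapping.lookup k i) + (\<Sum>j\<in>UNIV. V $ j $ i * m $ j)" for i
  proof -
    have "(exponent_int l - exponent_int k) $ i = (transpose V *v m) $ i"
      by (simp only: assms(1))
    then show ?thesis
      by (simp add: exponent_int_def matrix_vector_mult_def transpose_def)
  qed
  have "monomial_at l x = (\<Prod>i\<in>UNIV. x $ i powi int (Poly_Mapping.lookup l i))"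
    by (simp add: monomial_at_def)
  also have "\<dots> = (\<Prod>i\<in>UNIV. x $ i ^ Poly_Mapping.lookup k i * (\<Prod>j\<in>UNIV. x $ i powi (V $ j $ i * m $ j)))"
    by (intro prod.cong refl) (simp only: e power_int_add[OF disjI1[OF x0]] power_int_sum[OF x0] power_int_of_nat)
  also have "\<dots> = monomial_at k x * (\<Prod>i\<in>UNIV. \<Prod>j\<in>UNIV. x $ i powi (V $ j $ i * m $ j))"
    by (simp add: prod.distrib monomial_at_def)
  also have "(\<Prod>i\<in>UNIV. \<Prod>j\<in>UNIV. x $ i powi (V $ j $ i * m $ j))
      = (\<Prod>j\<in>UNIV. \<Prod>i\<in>UNIV. x $ i powi (V $ j $ i * m $ j))"
    by (rule prod.swap)
  also have "\<dots> = torus_character m (cox_map V x)"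
    by (simp add: torus_character_def cox_map_def prod_power_int power_int_mult)
  finally show ?thesis .
qed

lemma divisor_class_eqD:
  assumes "divisor_class V a = divisor_class V b"
  obtains m where "a - b = transpose V *v m"
proof -
  have "a - a = transpose V *v 0"
    by simp
  then have "a \<in> divisor_class V a"
    unfolding divisor_class_def by blast
  then have "a \<in> divisor_class V b"
    by (simp add: assms)
  then show thesis
    using that by (auto simp: divisor_class_def)
qed

text \<open>
  For functions on the positive orthant: constant on the fibres of the Cox map, with a Borel
  function of the torus coordinates as the function induced on the quotient.
\<close>

definition torus_borel :: "int^'k^'n::finite \<Rightarrow> (real^'k::finite \<Rightarrow> real) \<Rightarrow> bool" where
  "torus_borel V F \<longleftrightarrow>
     (\<exists>G\<in>borel_measurable borel. \<forall>x\<in>positive_orthant. F x = G (cox_map V x))"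

lemma torus_borel_divide:
  assumes "torus_borel V F" "torus_borel V F'"
  shows "torus_borel V (\<lambda>x. F x / F' x)"
proof -
  obtain G G' where [measurable]: "G \<in> borel_measurable borel" "G' \<in> borel_measurable borel"
    and "\<forall>x\<in>positive_orthant. F x = G (cox_map V x)" "\<forall>x\<in>positive_orthant. F' x = G' (cox_map V x)"
    using assms by (auto simp: torus_borel_def)
  then show ?thesis
    unfolding torus_borel_def by (intro bexI[of _ "\<lambda>t. G t / G' t"]) auto
qed

text \<open>
  The monomial \<open>x\<^sup>k\<close> is a common denominator that makes all the functions of degree \<open>d\<close> descend.
\<close>

lemma homogeneous_torus_borel:
  fixes V :: "int^'k^'n::finite" and f :: "'k::finite cox_poly"
  assumes "f \<noteq> 0" and hom: "homogeneous V d f" and k: "divisor_class V (exponent_int k) = d"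
  shows "torus_borel V (\<lambda>x. poly_at f x / monomial_at k x)"
    and "torus_borel V (\<lambda>x. trop_at f x / monomial_at k x)"
proof -
  let ?K = "Poly_Mapping.keys f" and ?c = "Poly_Mapping.lookup f"
  have "\<forall>l\<in>?K. \<exists>m. exponent_int l - exponent_int k = transpose V *v m"
    using hom k by (metis divisor_class_eqD homogeneous_def)
  then obtain m where m: "\<And>l. l \<in> ?K \<Longrightarrow> exponent_int l - exponent_int k = transpose V *v m l"
    by metis
  have quot: "monomial_at l x = monomial_at k x * torus_character (m l) (cox_map V x)"
    if "l \<in> ?K" "x \<in> positive_orthant" for l x
    using monomial_at_cox_map[OF m] that by blast
  have "poly_at f x / monomial_at k x = (\<Sum>l\<in>?K. ?c l * torus_character (m l) (cox_map V x))"
    if x: "x \<in> positive_orthant" for x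
    unfolding poly_at_def sum_divide_distrib
    by (intro sum.cong refl) (use quot[OF _ x] monomial_at_pos[OF x, of k] in simp)
  then show "torus_borel V (\<lambda>x. poly_at f x / monomial_at k x)"
    unfolding torus_borel_def
    by (intro bexI[of _ "\<lambda>t. \<Sum>l\<in>?K. ?c l * torus_character (m l) t"]) auto
  have "trop_at f x / monomial_at k x = Max ((\<lambda>l. torus_character (m l) (cox_map V x)) ` ?K)"
    if x: "x \<in> positive_orthant" for x
  proof -
    have "mono (\<lambda>y. y / monomial_at k x)"
      using monomial_at_pos[OF x, of k] by (auto intro!: monoI divide_right_mono)
    then have "trop_at f x / monomial_at k x
        = Max ((\<lambda>y. y / monomial_at k x) ` (\<lambda>l. monomial_at l x) ` ?K)"
      unfolding trop_at_def using assms(1) by (intro mono_Max_commute) auto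
    also have "(\<lambda>y. y / monomial_at k x) ` (\<lambda>l. monomial_at l x) ` ?K
        = (\<lambda>l. torus_character (m l) (cox_map V x)) ` ?K"
      unfolding image_image
      by (intro image_cong refl) (use quot[OF _ x] monomial_at_pos[OF x, of k] in simp)
    finally show ?thesis .
  qed
  then show "torus_borel V (\<lambda>x. trop_at f x / monomial_at k x)"
    unfolding torus_borel_def
    by (intro bexI[of _ "\<lambda>t. Max ((\<lambda>l. torus_character (m l) t) ` ?K)"]) auto
qed

lemma descend_cox_map:
  assumes "torus_borel V F" and "x \<in> positive_orthant"
  shows "descend V F (cox_map V x) = F x"
proof -
  have "\<exists>G. \<forall>x\<in>positive_orthant. G (cox_map V x) = F x"
    using assms(1) unfolding torus_borel_def by metis
  then have "\<forall>x\<in>positive_orthant. descend V F (cox_map V x) = F x"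
    unfolding descend_def by (rule someI_ex)
  then show ?thesis
    using assms(2) by blast
qed

lemma space_canonical_measure: "space (canonical_measure V) = positive_part V"
  by (simp add: canonical_measure_def space_restrict_space)

text \<open>The values that the choice in \<^const>\<open>descend\<close> takes off the positive part are arbitrary, but
  they lie outside the space of the measure.\<close>

lemma descend_measurable:
  assumes "torus_borel V F"
  shows "descend V F \<in> borel_measurable (canonical_measure V)"
proof -
  obtain G where G: "G \<in> borel_measurable borel"
    and FG: "\<forall>x\<in>positive_orthant. F x = G (cox_map V x)"
    using assms by (auto simp: torus_borel_def)
  have "G \<in> borel_measurable (restrict_space lborel (positive_part V))"
    using G by (intro measurable_restrict_space1) simp
  then have "G \<in> borel_measurable (canonical_measure V)"
    by (simp add: canonical_measure_def)
  moreover have "descend V F t = G t" if "t \<in> space (canonical_measure V)" for t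
    using that FG descend_cox_map[OF assms]
    by (auto simp: space_canonical_measure positive_part_def)
  ultimately show ?thesis
    by (simp cong: measurable_cong)
qed

section \<open>The mean square error of the estimator\<close>

theorem proposition4p2:
  fixes \<Delta> :: "(real^'n) set set"
    and V :: "int^'k^'n"
    and f g :: "'k::finite cox_poly"
    and d :: "(int^'k) set"
    and P :: "'w measure"
    and X :: "nat \<Rightarrow> 'w \<Rightarrow> real^'n"
    and N :: nat
  assumes "complete_rational_fan \<Delta>"
    and "ray_matrix \<Delta> V"
    and "f \<noteq> 0" and "g \<noteq> 0"
    and "positive_coeffs f" and "positive_coeffs g"
    and "d \<in> class_group V"
    and "homogeneous V d f" and "homogeneous V d g"
    and "aff_dim (newton_polytope g) = int CARD('n)"
    and "newton_polytope f \<subseteq> rel_interior (newton_polytope g)"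
    and "N \<ge> 1"
    and "prob_space P"
    and "prob_space.indep_vars P (\<lambda>_. trop_measure V f g) X {1..N}"
    and "\<forall>i\<in>{1..N}. distr P (trop_measure V f g) (X i) = trop_measure V f g"
  shows "sqrt (\<integral>w. (canonical_integral V f g - estimator V f g N (\<lambda>i. X i w))\<^sup>2 \<partial>P)
         \<le> trop_integral V f g * sqrt (((M2 f g)\<^sup>2 - (M1 f g)\<^sup>2) / real N)"
proof -
  interpret P: prob_space P
    by fact
  let ?\<mu> = "canonical_measure V" and ?Q = "trop_measure V f g" and ?c = "trop_integral V f g"
  let ?r = "ratio V f g" and ?t = "trop_ratio V f g" and ?h = "h_fun V f g"
  obtain k where "k \<in> Poly_Mapping.keys g"
    using \<open>g \<noteq> 0\<close> keys_eq_empty[of g] by blast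
  then have k: "divisor_class V (exponent_int k) = d"
    using \<open>homogeneous V d g\<close> by (simp add: homogeneous_def)
  note f = homogeneous_torus_borel[OF \<open>f \<noteq> 0\<close> \<open>homogeneous V d f\<close> k]
  note g = homogeneous_torus_borel[OF \<open>g \<noteq> 0\<close> \<open>homogeneous V d g\<close> k]
  have k0: "monomial_at k x \<noteq> 0" if "x \<in> positive_orthant" for x
    using monomial_at_pos[OF that, of k] by simp
  have cong: "torus_borel V F" if "torus_borel V F'" "\<And>x. x \<in> positive_orthant \<Longrightarrow> F x = F' x" for F F'
    using that by (simp add: torus_borel_def)
  have br: "torus_borel V (\<lambda>x. poly_at f x / poly_at g x)"
    by (rule cong[OF torus_borel_divide[OF f(1) g(1)]]) (simp add: k0)
  have bt: "torus_borel V (\<lambda>x. trop_at f x / trop_at g x)"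
    by (rule cong[OF torus_borel_divide[OF f(2) g(2)]]) (simp add: k0)
  have bh: "torus_borel V (\<lambda>x. (poly_at f x * trop_at g x) / (poly_at g x * trop_at f x))"
    by (rule cong[OF torus_borel_divide[OF br bt]]) simp
  have [measurable]: "?t \<in> borel_measurable ?\<mu>" "?h \<in> borel_measurable ?\<mu>"
    unfolding trop_ratio_def h_fun_def by (rule descend_measurable bt bh)+

  have pointwise: "?t t \<ge> 0 \<and> ?r t = ?t t * ?h t \<and> M1 f g \<le> ?h t \<and> ?h t \<le> M2 f g"
    if t\<mu>: "t \<in> space ?\<mu>" for t
  proof -
    obtain x where x: "x \<in> positive_orthant" and t: "t = cox_map V x"
      using t\<mu> by (auto simp: space_canonical_measure positive_part_def)
    note tp = trop_at_pos[OF \<open>f \<noteq> 0\<close> x] trop_at_pos[OF \<open>g \<noteq> 0\<close> x]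
    show ?thesis
      using poly_trop_quotient_bounds[OF \<open>f \<noteq> 0\<close> \<open>positive_coeffs f\<close> \<open>g \<noteq> 0\<close> \<open>positive_coeffs g\<close> x] tp
      unfolding t ratio_def trop_ratio_def h_fun_def
        descend_cox_map[OF br x] descend_cox_map[OF bt x] descend_cox_map[OF bh x]
      by (simp add: field_simps)
  qed

  have X1: "X 1 \<in> measurable P ?Q"
    using assms(12,14) by (auto simp: P.indep_vars_def)
  then have "prob_space ?Q"
    using P.prob_space_distr[OF X1] assms(12,15) by simp
  then have Q1: "emeasure ?Q (space ?Q) = 1"
    by (rule prob_space.emeasure_space_1)
  have "?c \<noteq> 0"
  proof
    assume "?c = 0"
    \<comment> \<open>As \<open>1 / 0 = 0\<close>, the density of the law would vanish identically.\<close>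
    then have "emeasure ?Q (space ?Q) = 0"
      by (simp add: trop_measure_def emeasure_density)
    with Q1 show False
      by simp
  qed
  moreover have "?c \<ge> 0"
    unfolding trop_integral_def using pointwise by (intro integral_nonneg_AE) auto
  ultimately have c: "?c > 0"
    by simp

  have spaceQ: "space ?Q = space ?\<mu>"
    by (simp add: trop_measure_def)
  have hQ: "?h \<in> borel_measurable ?Q"
    by (simp add: trop_measure_def)
  have "(\<integral>t. ?h t \<partial>?Q) = (\<integral>t. 1 / ?c * ?t t * ?h t \<partial>?\<mu>)"
    unfolding trop_measure_def
    by (rule integral_real_density) (use pointwise c in \<open>auto intro!: AE_I2\<close>)
  also have "\<dots> = (\<integral>t. 1 / ?c * ?r t \<partial>?\<mu>)"
    by (rule Bochner_Integration.integral_cong) (use pointwise in auto)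
  also have "\<dots> = canonical_integral V f g / ?c"
    by (simp add: canonical_integral_def)
  finally have mean: "canonical_integral V f g = ?c * (\<integral>t. ?h t \<partial>?Q)"
    using c by simp

  let ?E = "P.expectation (\<lambda>w. ((\<integral>t. ?h t \<partial>?Q) - (\<Sum>i=1..N. ?h (X i w)) / real N)\<^sup>2)"
  have "(canonical_integral V f g - estimator V f g N (\<lambda>i. X i w))\<^sup>2
      = ?c\<^sup>2 * ((\<integral>t. ?h t \<partial>?Q) - (\<Sum>i=1..N. ?h (X i w)) / real N)\<^sup>2" for w
    unfolding mean estimator_def power_mult_distrib[symmetric] by (simp add: right_diff_distrib)
  then have "sqrt (\<integral>w. (canonical_integral V f g - estimator V f g N (\<lambda>i. X i w))\<^sup>2 \<partial>P) = ?c * sqrt ?E"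
    using c by (simp add: real_sqrt_mult)
  also have "\<dots> \<le> ?c * sqrt (((M2 f g)\<^sup>2 - (M1 f g)\<^sup>2) / real N)"
  proof (intro mult_left_mono real_sqrt_le_mono)
    show "?E \<le> ((M2 f g)\<^sup>2 - (M1 f g)\<^sup>2) / real N"
      by (rule P.mean_square_error_le)
        (use assms(3-6,12,14,15) hQ pointwise M1_nonneg in \<open>auto simp: spaceQ\<close>)
  qed (use c in simp)
  finally show ?thesis .
qed

end
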